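(* For every $\alpha>0$ and every SNR $\Gamma>0$, the MP$\alpha$E exponent per unit bandwidth satisfies \[ F_{\alpha}(\Gamma)\leq\min\left\{ 2E_{0}(\alpha,\Gamma),\ \gamma_{\alpha}\Gamma\right\}, \] where \[ E_{0}(\rho,\Gamma)=\frac{1}{2}\left[(1-\beta_{0})(1+\rho)+\Gamma+\log\left(\beta_{0}-\frac{\Gamma}{1+\rho}\right)+\rho\log(\beta_{0})\right],\qquad \beta_{0}=\frac{1}{2}\left(1+\frac{\Gamma}{1+\rho}\right)\left[1+\sqrt{1-\frac{4\Gamma\rho}{(1+\rho+\Gamma)^{2}}}\right]. \]
   Context: Setting: a parameter $u\in[0,1)$ is to be conveyed over the continuous-time AWGN channel $y(t)=s(t,u)+z(t)$, where $z(t)$ is white Gaussian noise with two-sided spectral density $N_0/2$. A modulation–estimation system $\mathcal{S}_T$ of duration $T$ consists of a measurable modulator $u\mapsto s(\cdot,u)$ with $s(t,u)=0$ outside $[0,T]$, and an estimator mapping the received $\{y(t),0\le t\le T\}$ to an estimate $\hat u$. It is power-limited to $P$ if $\frac1T\int_0^T s^2(t,u)\,dt\le P$ for all $u$, and band-limited to $W$ if there is an orthonormal set $\{\phi_n\}_{n=1}^{N}$ of functions on $[0,T]$, $N=2WT$, such that every $s(\cdot,u)$ is a linear combination $\sum_{n=1}^N s_n(u)\phi_n(t)$. For $\alpha>0$ the mean power-$\alpha$ error (MP$\alpha$E) is $e_\alpha(\mathcal{S}_T)=\sup_{u\in[0,1)}\mathbb{E}_u|\hat u-u|^\alpha$ (expectation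 over the noise when the parameter is $u$). $E$ is an achievable MP$\alpha$E exponent if there is a family $\{\mathcal{S}_T\}$ (power-limited to $P$, band-limited to $W$) with $\limsup_{T\to\infty}[-\frac1T\log e_\alpha(\mathcal{S}_T)]\ge E$; $E_\alpha(P/N_0,W)$ is the largest achievable exponent. With the SNR $\Gamma=P/(N_0W)$, this exponent has the form $E_\alpha(P/N_0,W)=W\cdot F_\alpha(\Gamma)$, and $F_\alpha(\Gamma)$ is called the MP$\alpha$E exponent per unit bandwidth. The unlimited-bandwidth MP$\alpha$E exponent is $\gamma_\alpha=\lim_{\Gamma\to0}F_\alpha(\Gamma)/\Gamma$; equivalently, for systems without a bandwidth constraint the optimal MP$\alpha$E decays as $\exp(-\gamma_\alpha PT/N_0)$ to first order in the exponent. Logarithms are natural. *)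

theory Defs
  imports "HOL-Probability.Probability"
begin

text \<open>Continuous-time white Gaussian noise of two-sided spectral density N0/2 on [0,T],
  represented by its coordinates in an orthonormal basis of L2[0,T] (extending the
  band-limiting set phi_1..phi_N): an i.i.d. sequence of N(0, N0/2) variables.\<close>
definition noise :: "real \<Rightarrow> (nat \<Rightarrow> real) measure" where
  "noise N0 = PiM UNIV (\<lambda>_. density lborel (normal_density 0 (sqrt (N0 / 2))))"

definition dims :: "real \<Rightarrow> real \<Rightarrow> nat" where
  "dims W T = nat \<lfloor>2 * W * T\<rfloor>"

text \<open>A modulation-estimation system of duration T: modulator s (coordinates s u n of
  s(.,u) in the basis) and estimator est acting on the received coordinate sequence.\<close>
definition valid_system ::
  "real \<Rightarrow> real \<Rightarrow> real \<Rightarrow> (real \<Rightarrow> nat \<Rightarrow> real) \<Rightarrow> ((nat \<Rightarrow> real) \<Rightarrow> real) \<Rightarrow> bool" where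
  "valid_system P W T s est \<longleftrightarrow>
     s \<in> measurable (restrict_space borel {0..<1}) (PiM UNIV (\<lambda>_. borel)) \<and>
     est \<in> borel_measurable (PiM UNIV (\<lambda>_. borel)) \<and>
     (\<forall>u\<in>{0..<1}. (\<forall>n\<ge>dims W T. s u n = 0) \<and>
                    (\<Sum>n<dims W T. (s u n)\<^sup>2) \<le> P * T)"

definition mpae :: "real \<Rightarrow> real \<Rightarrow> (real \<Rightarrow> nat \<Rightarrow> real) \<Rightarrow> ((nat \<Rightarrow> real) \<Rightarrow> real) \<Rightarrow> ennreal" where
  "mpae \<alpha> N0 s est =
     (SUP u\<in>{0..<1}. \<integral>\<^sup>+ z. ennreal (\<bar>est (\<lambda>n. s u n + z n) - u\<bar> powr \<alpha>) \<partial>noise N0)"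

definition rate :: "real \<Rightarrow> ennreal \<Rightarrow> ereal" where
  "rate T e = (if e = 0 then \<infinity> else if e = \<top> then - \<infinity> else ereal (- ln (enn2real e) / T))"

definition achievable :: "real \<Rightarrow> real \<Rightarrow> real \<Rightarrow> real \<Rightarrow> real \<Rightarrow> bool" where
  "achievable \<alpha> P N0 W E \<longleftrightarrow>
     (\<exists>s est. (\<forall>T>0. valid_system P W T (s T) (est T)) \<and>
        Limsup at_top (\<lambda>T. rate T (mpae \<alpha> N0 (s T) (est T))) \<ge> ereal E)"

definition opt_exp :: "real \<Rightarrow> real \<Rightarrow> real \<Rightarrow> real \<Rightarrow> ereal" where
  "opt_exp \<alpha> P N0 W = Sup {ereal E | E. achievable \<alpha> P N0 W E}"

text \<open>Exponent per unit bandwidth: F_alpha(Gamma) = E_alpha(P/N0, W)/W with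
  Gamma = P/(N0 W); normalised by W = 1, N0 = 1, P = Gamma.\<close>
definition F_exp :: "real \<Rightarrow> real \<Rightarrow> ereal" where
  "F_exp \<alpha> \<Gamma> = opt_exp \<alpha> \<Gamma> 1 1"

definition gamma_exp :: "real \<Rightarrow> ereal" where
  "gamma_exp \<alpha> = Lim (at_right 0) (\<lambda>\<Gamma>. F_exp \<alpha> \<Gamma> / ereal \<Gamma>)"

definition beta0 :: "real \<Rightarrow> real \<Rightarrow> real" where
  "beta0 \<rho> \<Gamma> = 1/2 * (1 + \<Gamma> / (1 + \<rho>)) *
     (1 + sqrt (1 - 4 * \<Gamma> * \<rho> / (1 + \<rho> + \<Gamma>)\<^sup>2))"

definition E0 :: "real \<Rightarrow> real \<Rightarrow> real" where
  "E0 \<rho> \<Gamma> = 1/2 * ((1 - beta0 \<rho> \<Gamma>) * (1 + \<rho>) + \<Gamma>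
     + ln (beta0 \<rho> \<Gamma> - \<Gamma> / (1 + \<rho>)) + \<rho> * ln (beta0 \<rho> \<Gamma>))"

end

theory Submission
  imports Defs "HOL-Real_Asymp.Real_Asymp"
begin

text \<open>
  Using a system of power \<open>Q\<close> for the shorter duration \<open>P T / Q\<close> costs energy \<open>P T\<close> and no additional
  dimensions, so \<open>F(P) \<ge> (P / Q) F(Q)\<close> for \<open>P \<le> Q\<close>. Thus \<open>F(\<Gamma>) / \<Gamma>\<close> is nonincreasing, its limit at
  \<open>0\<close> is its supremum, and \<open>F(\<Gamma>) \<le> \<gamma> \<Gamma>\<close>.

  For the bound by \<open>2 E0\<close>, let \<open>p\<^sub>u\<close> be the density of the received vector, \<open>q\<close> a reference density,
  and \<open>r = \<bar>u - est\<bar> + \<delta>\<close>. With \<open>\<theta> = 1 / (1 + \<alpha>)\<close>, Hoelder's inequality applied to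
  \<open>p\<^sub>u\<^sup>\<theta> q\<^sup>1\<^sup>-\<^sup>\<theta> = (p\<^sub>u r\<^sup>\<alpha>)\<^sup>\<theta> (q / r)\<^sup>1\<^sup>-\<^sup>\<theta>\<close> bounds the error from below by the
  affinity of \<open>p\<^sub>u\<close> and \<open>q\<close>. The average over \<open>u\<close> of \<open>\<integral> q / r\<close> is only logarithmic in \<open>1 / \<delta>\<close>, hence
  subexponential for \<open>\<delta> = exp (- c T)\<close>. For a centred Gaussian \<open>q\<close> the affinity is explicit, depends
  on the signal only through its energy, and the best variance yields exactly \<open>2 E0\<close>.
\<close>

section \<open>Monotonicity in the signal-to-noise ratio\<close>

lemma rate_scale:
  assumes "k > 0"
  shows "rate T e = ereal k * rate (k * T) e"
  using assms by (auto simp: rate_def)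

text \<open>Multiplication by a positive constant maps the filter \<open>at_top\<close> onto itself,
  so a family of systems may be run on a rescaled clock.\<close>

lemma Limsup_at_top_scale:
  fixes k :: real and f :: "real \<Rightarrow> ereal"
  assumes "k > 0"
  shows "Limsup at_top (\<lambda>T. f (k * T)) = Limsup at_top f"
proof -
  have "filtermap ((*) k) at_top = at_top"
  proof (rule filtermap_fun_inverse)
    show "filterlim (\<lambda>x. (1 / k) * x) at_top at_top" "filterlim ((*) k) at_top at_top"
      using assms by (intro filterlim_tendsto_pos_mult_at_top[OF tendsto_const _ filterlim_ident], simp)+
  qed (use assms in simp)
  then show ?thesis
    using Limsup_filtermap_eq[of "(*) k" at_top f] assms by (simp add: inj_def)
qed

lemma achievable_scale:
  assumes "0 < P" "P \<le> Q" and "achievable \<alpha> Q N0 W E" and "W \<ge> 0"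
  shows "achievable \<alpha> P N0 W (P / Q * E)"
proof -
  define k where "k = P / Q"
  have k: "0 < k" "k \<le> 1" and Qk: "Q * k = P" using assms by (auto simp: k_def)
  obtain s est where v: "\<And>T. T > 0 \<Longrightarrow> valid_system Q W T (s T) (est T)"
    and lim: "Limsup at_top (\<lambda>T. rate T (mpae \<alpha> N0 (s T) (est T))) \<ge> ereal E"
    using assms(3) by (auto simp: achievable_def)
  have "valid_system P W T (s (k * T)) (est (k * T))" if T: "T > 0" for T
  proof -
    \<comment> \<open>The borrowed system lasts \<open>k * T\<close> \<le> \<open>T\<close>, so its
      coordinates fit into the dimensions available for duration \<open>T\<close>.\<close>
    have "W * (k * T) \<le> W * (1 * T)"
      using k T \<open>W \<ge> 0\<close> by (intro mult_left_mono mult_right_mono) auto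
    then have d: "dims W (k * T) \<le> dims W T"
      unfolding dims_def by (intro nat_mono floor_mono) simp
    have vs: "valid_system Q W (k * T) (s (k * T)) (est (k * T))" using v k T by simp
    \<comment> \<open>Coordinates between the two dimension counts vanish, so the energy is
      unchanged and the budget \<open>Q * (k * T)\<close> is exactly \<open>P * T\<close>.\<close>
    have "(\<Sum>n<dims W T. (s (k * T) u n)\<^sup>2) = (\<Sum>n<dims W (k * T). (s (k * T) u n)\<^sup>2)"
      if "u \<in> {0..<1}" for u
      using vs d that by (intro sum.mono_neutral_right) (auto simp: valid_system_def)
    moreover have "P * T = Q * (k * T)" using Qk by (simp add: mult.assoc[symmetric])
    ultimately show ?thesis using vs d unfolding valid_system_def by auto
  qed
  moreover have "ereal (k * E) \<le> Limsup at_top (\<lambda>T. rate T (mpae \<alpha> N0 (s (k * T)) (est (k * T))))"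
  proof -
    have "ereal (k * E) = ereal k * ereal E" by simp
    also have "\<dots> \<le> ereal k * Limsup at_top (\<lambda>T. rate T (mpae \<alpha> N0 (s T) (est T)))"
      using lim k by (intro ereal_mult_left_mono) auto
    also have "\<dots> = ereal k * Limsup at_top (\<lambda>T. rate (k * T) (mpae \<alpha> N0 (s (k * T)) (est (k * T))))"
      using Limsup_at_top_scale[OF k(1), of "\<lambda>T. rate T (mpae \<alpha> N0 (s T) (est T))"] by simp
    also have "\<dots> = Limsup at_top (\<lambda>T. ereal k * rate (k * T) (mpae \<alpha> N0 (s (k * T)) (est (k * T))))"
      using k by (subst Limsup_ereal_mult_left) auto
    also have "\<dots> = Limsup at_top (\<lambda>T. rate T (mpae \<alpha> N0 (s (k * T)) (est (k * T))))"
      by (simp only: rate_scale[OF k(1), symmetric])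
    finally show ?thesis .
  qed
  ultimately show ?thesis
    unfolding achievable_def k_def
    by (intro exI[of _ "\<lambda>T. s (P / Q * T)"] exI[of _ "\<lambda>T. est (P / Q * T)"]) auto
qed

lemma F_exp_ratio_antimono:
  assumes "0 < P" "P \<le> Q"
  shows "F_exp \<alpha> Q / ereal Q \<le> F_exp \<alpha> P / ereal P"
proof -
  \<comment> \<open>Multiplied out, the claim is an upper bound on a supremum and can be checked for
    each achievable exponent separately.\<close>
  have "F_exp \<alpha> Q \<le> F_exp \<alpha> P / ereal P * ereal Q"
    unfolding F_exp_def opt_exp_def
  proof (rule Sup_least, clarify)
    fix E assume "achievable \<alpha> Q 1 1 E"
    then have "achievable \<alpha> P 1 1 (P / Q * E)" using assms achievable_scale by simp
    then have "ereal (P / Q * E) \<le> Sup {ereal E | E. achievable \<alpha> P 1 1 E}"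
      by (intro Sup_upper) auto
    then have "ereal (P / Q * E) / ereal P * ereal Q \<le> Sup {ereal E | E. achievable \<alpha> P 1 1 E} / ereal P * ereal Q"
      using assms by (intro ereal_mult_right_mono ereal_divide_right_mono) auto
    then show "ereal E \<le> Sup {ereal E | E. achievable \<alpha> P 1 1 E} / ereal P * ereal Q"
      using assms by simp
  qed
  then show ?thesis using assms by (subst ereal_divide_le_pos) (auto simp: mult.commute)
qed

text \<open>A function that grows as its argument decreases to 0 converges to its supremum, which
  always exists in \<open>ereal\<close>.\<close>

lemma Lim_at_right_0_antimono:
  fixes f :: "real \<Rightarrow> ereal"
  assumes "\<And>x y. 0 < x \<Longrightarrow> x \<le> y \<Longrightarrow> f y \<le> f x" and "x > 0"
  shows "f x \<le> Lim (at_right 0) f"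
proof -
  define S where "S = (SUP y\<in>{0<..}. f y)"
  have "(f \<longlongrightarrow> S) (at_right 0)"
  proof (rule order_tendstoI)
    fix a assume "a < S"
    then obtain y where y: "y > 0" "a < f y" by (auto simp: S_def less_SUP_iff)
    have "\<forall>\<^sub>F z in at_right 0. z \<in> {0<..<y}" using y by (intro eventually_at_right_real)
    then show "\<forall>\<^sub>F z in at_right 0. a < f z"
      by eventually_elim (use y assms(1) in \<open>auto intro: less_le_trans\<close>)
  next
    fix a assume "S < a"
    have "\<forall>\<^sub>F z::real in at_right 0. z > 0" by (rule eventually_at_right_less)
    then show "\<forall>\<^sub>F z in at_right 0. f z < a"
      by eventually_elim (use \<open>S < a\<close> in \<open>auto simp: S_def intro: le_less_trans[OF SUP_upper]\<close>)
  qed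
  \<comment> \<open>\<open>Lim\<close> is a description operator; the convergence just shown is what
    identifies its value.\<close>
  then have "Lim (at_right 0) f = S" by (intro tendsto_Lim) auto
  then show ?thesis using \<open>x > 0\<close> by (auto simp: S_def intro: SUP_upper)
qed

lemma F_exp_le_gamma_exp:
  assumes "\<Gamma> > 0"
  shows "F_exp \<alpha> \<Gamma> \<le> gamma_exp \<alpha> * ereal \<Gamma>"
proof -
  have "F_exp \<alpha> \<Gamma> / ereal \<Gamma> \<le> gamma_exp \<alpha>"
    unfolding gamma_exp_def
    using F_exp_ratio_antimono assms by (intro Lim_at_right_0_antimono) auto
  then show ?thesis using assms by (subst (asm) ereal_divide_le_pos) (auto simp: mult.commute)
qed

section \<open>Gallager's function and Gaussian affinities\<close>

text \<open>In units of the noise variance, \<open>opt_var\<close> is the output variance that maximises the Gaussian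
  affinity computed below; Gallager's \<open>beta0\<close> is this variance in the form
  \<open>(opt_var + \<rho>) / (1 + \<rho>)\<close>.\<close>
definition opt_var :: "real \<Rightarrow> real \<Rightarrow> real" where
  "opt_var \<rho> \<Gamma> = (1 + \<rho>) * beta0 \<rho> \<Gamma> - \<rho>"

text \<open>The explicit formula is the larger root of this quadratic: the second claim puts it at
  or above the midpoint of the two roots. Later arguments use only these two facts and never the
  square root.\<close>

lemma beta0_quadratic:
  assumes "\<rho> > 0" "\<Gamma> > 0"
  shows "(1 + \<rho>) * (beta0 \<rho> \<Gamma>)\<^sup>2 - (1 + \<rho> + \<Gamma>) * beta0 \<rho> \<Gamma> + \<Gamma> * \<rho> / (1 + \<rho>) = 0"
    and "2 * (1 + \<rho>) * beta0 \<rho> \<Gamma> \<ge> 1 + \<rho> + \<Gamma>"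
proof -
  define D where "D = sqrt (1 - 4 * \<Gamma> * \<rho> / (1 + \<rho> + \<Gamma>)\<^sup>2)"
  have p: "1 + \<rho> + \<Gamma> > 0" using assms by simp
  \<comment> \<open>Written this way the discriminant is visibly positive, so the square root in
    \<open>beta0\<close> has a nonnegative argument.\<close>
  have "(1 + \<rho> + \<Gamma>)\<^sup>2 - 4 * \<Gamma> * \<rho> = 1 + 2 * \<rho> + 2 * \<Gamma> + (\<rho> - \<Gamma>)\<^sup>2"
    by (simp add: power2_eq_square algebra_simps)
  then have "4 * \<Gamma> * \<rho> \<le> (1 + \<rho> + \<Gamma>)\<^sup>2" using assms zero_le_power2[of "\<rho> - \<Gamma>"] by linarith
  then have "1 - 4 * \<Gamma> * \<rho> / (1 + \<rho> + \<Gamma>)\<^sup>2 \<ge> 0" using p by simp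
  then have D2: "D\<^sup>2 = 1 - 4 * \<Gamma> * \<rho> / (1 + \<rho> + \<Gamma>)\<^sup>2" and D0: "D \<ge> 0" by (auto simp: D_def)
  have b: "beta0 \<rho> \<Gamma> = (1 + \<rho> + \<Gamma>) / (2 * (1 + \<rho>)) * (1 + D)"
    using assms by (simp add: beta0_def D_def field_simps)
  define B where "B = 1 + \<rho> + \<Gamma>"
  have "B > 0" "D\<^sup>2 * B\<^sup>2 = B\<^sup>2 - 4 * \<Gamma> * \<rho>"
    using p D2 unfolding B_def by (simp_all add: left_diff_distrib)
  then show "(1 + \<rho>) * (beta0 \<rho> \<Gamma>)\<^sup>2 - (1 + \<rho> + \<Gamma>) * beta0 \<rho> \<Gamma> + \<Gamma> * \<rho> / (1 + \<rho>) = 0"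
    unfolding b B_def[symmetric] using assms
    by (simp add: power2_eq_square divide_simps) (algebra)
  have "2 * (1 + \<rho>) * beta0 \<rho> \<Gamma> = (1 + \<rho> + \<Gamma>) * (1 + D)" using assms by (simp add: b)
  moreover have "(1 + \<rho> + \<Gamma>) * D \<ge> 0" using p D0 by simp
  ultimately show "2 * (1 + \<rho>) * beta0 \<rho> \<Gamma> \<ge> 1 + \<rho> + \<Gamma>" by (simp add: distrib_left)
qed

text \<open>In terms of \<open>v\<close> the quadratic becomes
  \<open>v^2 + v * (\<rho> - 1 - \<Gamma>) = \<rho>\<close>, the stationarity condition for the
  exponent as a function of the reference variance. Its roots have product -\<rho> < 0, and
  \<open>v\<close> is the larger one.\<close>

lemma opt_var_pos:
  assumes "\<rho> > 0" "\<Gamma> > 0"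
  shows "opt_var \<rho> \<Gamma> > 0"
proof (rule ccontr)
  define v where "v = opt_var \<rho> \<Gamma>"
  have b: "beta0 \<rho> \<Gamma> = (v + \<rho>) / (1 + \<rho>)" using assms by (simp add: v_def opt_var_def)
  have q: "v\<^sup>2 + v * (\<rho> - 1 - \<Gamma>) = \<rho>"
    using beta0_quadratic(1)[OF assms] assms unfolding b
    by (simp add: power2_eq_square divide_simps) (algebra)
  have "2 * v \<ge> 1 + \<Gamma> - \<rho>"
    using beta0_quadratic(2)[OF assms] by (simp add: v_def opt_var_def algebra_simps)
  moreover assume "\<not> opt_var \<rho> \<Gamma> > 0"
  then have "v \<le> 0" by (simp add: v_def)
  ultimately have "v * (v + (\<rho> - 1 - \<Gamma>)) \<le> 0"
    by (intro mult_nonpos_nonneg) auto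
  with q assms show False by (simp add: power2_eq_square algebra_simps)
qed

text \<open>The right-hand side is the Gaussian affinity exponent for reference variance
  \<open>v\<close>, with two dimensions and energy \<Gamma> per unit time. This is the form in which
  \<open>system_converse\<close> delivers the bound.\<close>

lemma two_E0_eq:
  assumes "\<rho> > 0" "\<Gamma> > 0"
  defines "v \<equiv> opt_var \<rho> \<Gamma>"
  shows "2 * E0 \<rho> \<Gamma> = (1 + \<rho>) * ln ((v + \<rho>) / (1 + \<rho>)) - ln v + \<rho> * \<Gamma> / (v + \<rho>)"
proof -
  define b where "b = beta0 \<rho> \<Gamma>"
  have v: "v > 0" using opt_var_pos assms by simp
  have vb: "v = (1 + \<rho>) * b - \<rho>" by (simp add: v_def opt_var_def b_def)
  then have b: "b = (v + \<rho>) / (1 + \<rho>)" using assms by simp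
  then have b0: "b > 0" using v assms by simp
  have q: "(1 + \<rho>) * b\<^sup>2 - (1 + \<rho> + \<Gamma>) * b + \<Gamma> * \<rho> / (1 + \<rho>) = 0"
    using beta0_quadratic[OF assms(1,2)] by (simp add: b_def)
  \<comment> \<open>A factored form of the quadratic; it splits the first logarithm of
    \<open>E0\<close>. The same quadratic then turns the remaining rational terms into \<rho> *
    \<Gamma> / (v + \<rho>).\<close>
  have "v * (b - \<Gamma> / (1 + \<rho>)) = b"
    using q assms by (simp add: vb power2_eq_square divide_simps) (algebra)
  then have "b - \<Gamma> / (1 + \<rho>) = b / v" using v by (simp add: field_simps)
  then have l: "ln (b - \<Gamma> / (1 + \<rho>)) = ln b - ln v" using v b0 by (simp add: ln_div)
  have "\<rho> * \<Gamma> / (1 + \<rho>) = b * ((1 - b) * (1 + \<rho>) + \<Gamma>)"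
    using q by (simp add: power2_eq_square algebra_simps)
  moreover have "\<rho> * \<Gamma> / (v + \<rho>) = \<rho> * \<Gamma> / (1 + \<rho>) / b" using assms by (simp add: b)
  ultimately have "\<rho> * \<Gamma> / (v + \<rho>) = (1 - b) * (1 + \<rho>) + \<Gamma>" using b0 by simp
  then show ?thesis unfolding E0_def b_def[symmetric] l b[symmetric] by (simp add: algebra_simps)
qed

text \<open>Weighted AM-GM for \<open>v\<close> and 1 with weights \<open>1 / (1 + \<rho>)\<close>
  and \<open>\<rho> / (1 + \<rho>)\<close>. It makes the cost per dimension nonnegative, so a
  dimension count may be replaced by an upper bound.\<close>

lemma ln_shifted_mean_ge:
  fixes \<rho> v :: real
  assumes "\<rho> > 0" "v > 0"
  shows "ln v \<le> (1 + \<rho>) * ln ((v + \<rho>) / (1 + \<rho>))"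
proof -
  have "v powr (1 / (1 + \<rho>)) * 1 powr (\<rho> / (1 + \<rho>)) \<le> (1 / (1 + \<rho>)) * v + (\<rho> / (1 + \<rho>)) * 1"
    using assms by (intro Youngs_inequality_0) (auto simp: field_simps)
  then have "v powr (1 / (1 + \<rho>)) \<le> (v + \<rho>) / (1 + \<rho>)"
    by (simp add: add_divide_distrib)
  then have "ln (v powr (1 / (1 + \<rho>))) \<le> ln ((v + \<rho>) / (1 + \<rho>))"
    using assms by (subst ln_le_cancel_iff) auto
  then show ?thesis using assms by (simp add: ln_powr field_simps)
qed

text \<open>Densities with respect to \<open>N(0, 1/2)\<close>: \<open>tilt x\<close> is that of \<open>N(x, 1/2)\<close> and
  \<open>widen v\<close> that of \<open>N(0, v/2)\<close>.\<close>
definition tilt :: "real \<Rightarrow> real \<Rightarrow> real" where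
  "tilt x y = exp (2 * x * y - x\<^sup>2)"

definition widen :: "real \<Rightarrow> real \<Rightarrow> real" where
  "widen v y = exp ((1 - 1 / v) * y\<^sup>2) / sqrt v"

abbreviation gauss :: "real measure" where
  "gauss \<equiv> density lborel (normal_density 0 (sqrt (1 / 2)))"

section \<open>One-dimensional Gaussian integrals\<close>

lemma normal_density_half: "normal_density m (sqrt (v / 2)) y = exp (- (y - m)\<^sup>2 / v) / sqrt (pi * v)"
  if "v > 0"
  using that by (simp add: normal_density_def mult.commute)

lemma tilt_pos [simp]: "tilt x y > 0" by (simp add: tilt_def)
lemma widen_pos [simp]: "v > 0 \<Longrightarrow> widen v y > 0" by (simp add: widen_def)
lemma tilt_measurable [measurable]: "tilt x \<in> borel_measurable borel" unfolding tilt_def by measurable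
lemma widen_measurable [measurable]: "widen v \<in> borel_measurable borel" unfolding widen_def by measurable

lemma nn_integral_normal_density: "0 < s \<Longrightarrow> (\<integral>\<^sup>+y. ennreal (normal_density m s y) \<partial>lborel) = 1"
  by (subst nn_integral_eq_integral) auto

lemma nn_integral_widen:
  assumes "v > 0"
  shows "(\<integral>\<^sup>+y. ennreal (widen v y) \<partial>gauss) = 1"
proof -
  have "normal_density 0 (sqrt (1 / 2)) y * widen v y = normal_density 0 (sqrt (v / 2)) y" for y
    using assms by (simp add: normal_density_half widen_def real_sqrt_mult exp_add[symmetric] mult_exp_exp algebra_simps)
  then show ?thesis
    by (subst nn_integral_density) (auto simp: ennreal_mult[symmetric] nn_integral_normal_density assms less_imp_le[OF widen_pos[OF assms]])
qed

text \<open>Completing the square: against the base density, the integrand is a constant times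
  another normal density. The constant is kept as an exponential so that the product over
  coordinates becomes a sum.\<close>

lemma nn_integral_tilt_widen:
  assumes "\<rho> > 0" "v > 0"
  shows "(\<integral>\<^sup>+y. ennreal (tilt x y powr (1 / (1 + \<rho>)) * widen v y powr (\<rho> / (1 + \<rho>))) \<partial>gauss) =
    ennreal (exp (- (ln v * (\<rho> / (1 + \<rho>)) + ln ((v + \<rho>) / ((1 + \<rho>) * v))) / 2 - \<rho> * x\<^sup>2 / ((1 + \<rho>) * (v + \<rho>))))"
    (is "?L = ennreal ?R")
proof -
  \<comment> \<open>In units where the noise has precision 1, \<kappa> is the weighted mean of the
    precisions 1 and \<open>1 / v\<close>; \<open>m\<close> is the centre of the resulting
    Gaussian.\<close>
  define \<kappa> where "\<kappa> = (v + \<rho>) / ((1 + \<rho>) * v)"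
  have k: "\<kappa> > 0" using assms by (simp add: \<kappa>_def)
  define m where "m = v * x / (v + \<rho>)"
  have id: "- y\<^sup>2 + (2 * x * y - x\<^sup>2) / (1 + \<rho>) + (1 - 1 / v) * y\<^sup>2 * \<rho> / (1 + \<rho>)
      = - \<kappa> * (y - m)\<^sup>2 - \<rho> * x\<^sup>2 / ((1 + \<rho>) * (v + \<rho>))" for y
  proof -
    define a where "a = 1 + \<rho>"
    have a: "\<rho> = a - 1" "a \<noteq> 0" "v + \<rho> \<noteq> 0" using assms by (auto simp: a_def)
    have km: "\<kappa> * m = x / (1 + \<rho>)" using assms by (simp add: \<kappa>_def m_def)
    have "\<kappa> * (y - m)\<^sup>2 = \<kappa> * y\<^sup>2 - 2 * (\<kappa> * m) * y + (\<kappa> * m) * m"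
      by (simp add: power2_eq_square algebra_simps)
    also have "\<dots> = \<kappa> * y\<^sup>2 - 2 * x * y / (1 + \<rho>) + v * x\<^sup>2 / ((1 + \<rho>) * (v + \<rho>))"
      unfolding km by (simp add: m_def power2_eq_square)
    also have "v * x\<^sup>2 / ((1 + \<rho>) * (v + \<rho>)) = x\<^sup>2 / (1 + \<rho>) - \<rho> * x\<^sup>2 / ((1 + \<rho>) * (v + \<rho>))"
      using assms a by (simp add: divide_simps) (simp add: algebra_simps)
    also have "\<kappa> * y\<^sup>2 = y\<^sup>2 - (1 - 1 / v) * y\<^sup>2 * \<rho> / (1 + \<rho>)"
      using assms a by (simp add: \<kappa>_def divide_simps) (simp add: algebra_simps)
    finally show ?thesis by (simp add: diff_divide_distrib)
  qed
  \<comment> \<open>Collects the normalising constants: one factor from the new Gaussian and one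
    from the power of \<open>widen\<close>.\<close>
  have e: "exp (- (ln v * (\<rho> / (1 + \<rho>)) + ln \<kappa>) / 2) = sqrt (1 / \<kappa>) / (sqrt v) powr (\<rho> / (1 + \<rho>))"
  proof -
    have "exp (- (ln v * (\<rho> / (1 + \<rho>)) + ln \<kappa>) / 2) = exp (- ln \<kappa> / 2) / exp (ln v * (\<rho> / (1 + \<rho>)) / 2)"
      by (simp add: exp_diff[symmetric] add_divide_distrib diff_divide_distrib)
    moreover have "exp (- ln \<kappa> / 2) = sqrt (1 / \<kappa>)"
      using k by (simp add: ln_sqrt[symmetric] exp_minus real_sqrt_divide inverse_eq_divide)
    moreover have "exp (ln v * (\<rho> / (1 + \<rho>)) / 2) = (sqrt v) powr (\<rho> / (1 + \<rho>))"
      using assms by (simp add: powr_def ln_sqrt mult.commute)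
    ultimately show ?thesis by simp
  qed
  have frac: "a / p * (b * (c / q)) = a * b * c / (p * q)" for a b c p q :: real by simp
  have "normal_density 0 (sqrt (1 / 2)) y * (tilt x y powr (1 / (1 + \<rho>)) * widen v y powr (\<rho> / (1 + \<rho>)))
      = ?R * normal_density m (sqrt ((1 / \<kappa>) / 2)) y" for y
  proof -
    have 1: "tilt x y powr (1 / (1 + \<rho>)) = exp ((2 * x * y - x\<^sup>2) / (1 + \<rho>))"
      by (simp add: tilt_def powr_def)
    have 2: "widen v y powr (\<rho> / (1 + \<rho>)) = exp ((1 - 1 / v) * y\<^sup>2 * \<rho> / (1 + \<rho>)) / sqrt v powr (\<rho> / (1 + \<rho>))"
      using assms by (simp add: widen_def powr_divide) (simp add: powr_def mult_ac)
    have 3: "normal_density m (sqrt ((1 / \<kappa>) / 2)) y = exp (- \<kappa> * (y - m)\<^sup>2) / (sqrt pi * sqrt (1 / \<kappa>))"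
      using k by (subst normal_density_half) (auto simp: real_sqrt_mult real_sqrt_divide mult.commute)
    have 4: "normal_density 0 (sqrt (1 / 2)) y = exp (- y\<^sup>2) / sqrt pi"
      by (subst normal_density_half) auto
    have "normal_density 0 (sqrt (1 / 2)) y * (tilt x y powr (1 / (1 + \<rho>)) * widen v y powr (\<rho> / (1 + \<rho>)))
      = exp (- y\<^sup>2 + (2 * x * y - x\<^sup>2) / (1 + \<rho>) + (1 - 1 / v) * y\<^sup>2 * \<rho> / (1 + \<rho>)) / (sqrt pi * sqrt v powr (\<rho> / (1 + \<rho>)))"
      unfolding 1 2 4 by (simp only: frac exp_add)
    also have "\<dots> = exp (- (ln v * (\<rho> / (1 + \<rho>)) + ln \<kappa>) / 2) * exp (- \<rho> * x\<^sup>2 / ((1 + \<rho>) * (v + \<rho>))) * normal_density m (sqrt ((1 / \<kappa>) / 2)) y"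
      unfolding id e 3 using k assms by (simp add: exp_diff exp_minus field_simps)
    also have "\<dots> = ?R * normal_density m (sqrt ((1 / \<kappa>) / 2)) y"
      by (simp add: \<kappa>_def exp_add[symmetric] mult_exp_exp)
    finally show ?thesis .
  qed
  then have "?L = (\<integral>\<^sup>+y. ennreal ?R * ennreal (normal_density m (sqrt ((1 / \<kappa>) / 2)) y) \<partial>lborel)"
    by (subst nn_integral_density) (auto simp: ennreal_mult[symmetric])
  also have "\<dots> = ennreal ?R"
    by (subst nn_integral_cmult) (use k in \<open>auto simp: nn_integral_normal_density\<close>)
  finally show ?thesis .
qed

text \<open>Translation formula in one dimension: \<open>tilt x\<close> is the likelihood ratio of
  the translated law to the noise law.\<close>

lemma emeasure_gauss_shift:
  assumes [measurable]: "A \<in> sets borel"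
  shows "emeasure gauss {z. x + z \<in> A} = (\<integral>\<^sup>+y. ennreal (tilt x y) * indicator A y \<partial>gauss)"
proof -
  have nd: "normal_density 0 (sqrt (1 / 2)) (y - x) = normal_density 0 (sqrt (1 / 2)) y * tilt x y" for y
    by (simp add: normal_density_def tilt_def mult_exp_exp power2_eq_square algebra_simps)
  have "emeasure gauss {z. x + z \<in> A} = (\<integral>\<^sup>+z. ennreal (normal_density 0 (sqrt (1 / 2)) z) * indicator A (x + z) \<partial>lborel)"
    by (subst emeasure_density) (auto intro!: nn_integral_cong split: split_indicator)
  also have "\<dots> = (\<integral>\<^sup>+y. ennreal (normal_density 0 (sqrt (1 / 2)) (y - x)) * indicator A y \<partial>lborel)"
    by (subst (2) nn_integral_real_affine[where c = 1 and t = x]) auto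
  also have "\<dots> = (\<integral>\<^sup>+y. ennreal (tilt x y) * indicator A y \<partial>gauss)"
    by (subst nn_integral_density) (auto simp: nd ennreal_mult mult_ac less_imp_le intro!: nn_integral_cong)
  finally show ?thesis .
qed

section \<open>Shifted noise and averaging over the parameter\<close>

text \<open>The integrand sees only the coordinates in \<open>J\<close>, and the marginal on
  \<open>J\<close> is a finite product measure, where the integral factors.\<close>

lemma (in product_prob_space) nn_integral_PiM_prod:
  assumes J: "finite J" "J \<subseteq> I" and g: "\<And>i. i \<in> J \<Longrightarrow> g i \<in> borel_measurable (M i)"
  shows "(\<integral>\<^sup>+y. (\<Prod>i\<in>J. g i (y i)) \<partial>PiM I M) = (\<Prod>i\<in>J. integral\<^sup>N (M i) (g i))"
proof -
  note g [measurable]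
  have "(\<integral>\<^sup>+y. (\<Prod>i\<in>J. g i (y i)) \<partial>PiM I M) =
      (\<integral>\<^sup>+y. (\<Prod>i\<in>J. g i (restrict y J i)) \<partial>PiM I M)"
    by (auto intro!: nn_integral_cong prod.cong)
  also have "\<dots> = (\<integral>\<^sup>+y. (\<Prod>i\<in>J. g i (y i)) \<partial>distr (PiM I M) (PiM J M) (\<lambda>y. restrict y J))"
    using J by (subst nn_integral_distr) (auto intro!: measurable_restrict_subset)
  also have "\<dots> = (\<integral>\<^sup>+y. (\<Prod>i\<in>J. g i (y i)) \<partial>PiM J M)"
    using J by (simp add: distr_PiM_restrict_finite)
  also have "\<dots> = (\<Prod>i\<in>J. integral\<^sup>N (M i) (g i))"
    using J g by (intro product_nn_integral_prod)
  finally show ?thesis .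
qed

interpretation gauss: prob_space gauss
  by (rule prob_space_normal_density) simp

interpretation noise: product_prob_space "\<lambda>_::nat. gauss" UNIV ..

lemma noise_1: "noise 1 = PiM UNIV (\<lambda>_. gauss)"
  by (simp add: noise_def)

lemma sets_noise [measurable_cong]: "sets (noise N0) = sets (PiM UNIV (\<lambda>_. borel))"
  unfolding noise_def by (rule sets_PiM_cong) auto

lemma space_noise [simp]: "space (noise N0) = UNIV"
  by (simp add: noise_def space_PiM)

lemma prob_space_noise_1: "prob_space (noise 1)"
  unfolding noise_1 by (rule noise.P.prob_space_axioms)

lemma nn_integral_noise_prod:
  assumes "finite J" "\<And>n. g n \<in> borel_measurable borel"
  shows "(\<integral>\<^sup>+y. (\<Prod>n\<in>J. g n (y n)) \<partial>noise 1) = (\<Prod>n\<in>J. \<integral>\<^sup>+y. g n y \<partial>gauss)"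
  unfolding noise_1 using assms by (intro noise.nn_integral_PiM_prod) auto

lemma measurable_noise_shift: "(\<lambda>z n. x n + z n) \<in> measurable (noise N0) (noise N1)"
  unfolding measurable_cong_sets[OF refl sets_noise]
  by (rule measurable_PiM_single') auto

text \<open>Only finitely many coordinates move, so the likelihood ratio is a finite product even
  for the infinite sequence. Equality is tested on cylinder sets, which determine a finite
  measure.\<close>

lemma distr_noise_shift:
  assumes x: "\<And>n. n \<ge> N \<Longrightarrow> x n = 0"
  shows "distr (noise 1) (noise 1) (\<lambda>z n. x n + z n) =
    density (noise 1) (\<lambda>y. \<Prod>n<N. ennreal (tilt (x n) (y n)))"
proof (rule measure_eqI_PiM_infinite[where I = UNIV and M = "\<lambda>_. gauss"])
  note sh = measurable_noise_shift[of x 1 1]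
  show "sets (distr (noise 1) (noise 1) (\<lambda>z n. x n + z n)) = sets (PiM UNIV (\<lambda>_. gauss))"
    "sets (density (noise 1) (\<lambda>y. \<Prod>n<N. ennreal (tilt (x n) (y n)))) = sets (PiM UNIV (\<lambda>_. gauss))"
    by (simp_all add: noise_1)
  show "finite_measure (distr (noise 1) (noise 1) (\<lambda>z n. x n + z n))"
    by (intro prob_space.finite_measure prob_space.prob_space_distr prob_space_noise_1 sh)
  fix A :: "nat \<Rightarrow> real set" and J :: "nat set"
  assume J: "finite J" "J \<subseteq> UNIV" and A: "\<And>i. i \<in> J \<Longrightarrow> A i \<in> sets gauss"
  let ?E = "prod_emb UNIV (\<lambda>_. gauss) J (Pi\<^sub>E J A)"
  define B where "B n = (if n \<in> J then A n else UNIV)" for n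
  have B [measurable]: "B n \<in> sets borel" for n using A by (auto simp: B_def)
  \<comment> \<open>Padding the cylinder with trivial factors lets the event and the density factor
    over one common finite index set.\<close>
  define K where "K = J \<union> {..<N}"
  have K: "finite K" using J by (simp add: K_def)
  have E: "?E = {y. \<forall>n\<in>K. y n \<in> B n}"
    by (auto simp: prod_emb_def K_def B_def PiE_iff)
  have Em: "?E \<in> sets (noise 1)" unfolding noise_1 using J A by (intro sets_PiM_I) auto
  have c: "(\<Prod>n\<in>K. emeasure gauss {z. x n + z \<in> B n}) = emeasure (noise 1) {y. \<forall>n\<in>K. x n + y n \<in> B n}"
  proof -
    have "{z. x n + z \<in> B n} \<in> sets borel" for n by measurable
    then show ?thesis
      using noise.emeasure_PiM_Collect[of K "\<lambda>n. {z. x n + z \<in> B n}"] K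
      by (simp add: noise_1 space_PiM)
  qed
  have "emeasure (distr (noise 1) (noise 1) (\<lambda>z n. x n + z n)) ?E = emeasure (noise 1) {y. \<forall>n\<in>K. x n + y n \<in> B n}"
    using Em by (subst emeasure_distr[OF sh]) (auto simp: E vimage_def)
  also have "\<dots> = (\<Prod>n\<in>K. \<integral>\<^sup>+y. ennreal (tilt (x n) y) * indicator (B n) y \<partial>gauss)"
    unfolding c[symmetric] by (simp add: emeasure_gauss_shift)
  also have "\<dots> = (\<integral>\<^sup>+y. (\<Prod>n\<in>K. ennreal (tilt (x n) (y n)) * indicator (B n) (y n)) \<partial>noise 1)"
    using K by (subst nn_integral_noise_prod) auto
  also have "\<dots> = (\<integral>\<^sup>+y. (\<Prod>n<N. ennreal (tilt (x n) (y n))) * indicator ?E y \<partial>noise 1)"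
  proof (rule nn_integral_cong)
    fix y
    \<comment> \<open>From \<open>N\<close> on the shift is 0, and \<open>tilt 0\<close> is
      identically 1.\<close>
    have "(\<Prod>n\<in>K. ennreal (tilt (x n) (y n))) = (\<Prod>n<N. ennreal (tilt (x n) (y n)))"
      using K x by (intro prod.mono_neutral_right) (auto simp: K_def tilt_def)
    moreover have "(\<Prod>n\<in>K. indicator (B n) (y n)) = (indicator ?E y :: ennreal)"
    proof (cases "\<forall>n\<in>K. y n \<in> B n")
      case False
      then show ?thesis using K unfolding E by (auto simp: prod_zero_iff indicator_def)
    qed (simp add: E)
    ultimately show "(\<Prod>n\<in>K. ennreal (tilt (x n) (y n)) * indicator (B n) (y n)) =
        (\<Prod>n<N. ennreal (tilt (x n) (y n))) * indicator ?E y"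
      by (simp add: prod.distrib)
  qed
  also have "\<dots> = emeasure (density (noise 1) (\<lambda>y. \<Prod>n<N. ennreal (tilt (x n) (y n)))) ?E"
    using Em by (subst emeasure_density) auto
  finally show "emeasure (distr (noise 1) (noise 1) (\<lambda>z n. x n + z n)) ?E =
     emeasure (density (noise 1) (\<lambda>y. \<Prod>n<N. ennreal (tilt (x n) (y n)))) ?E" .
qed

lemma nn_integral_noise_shift:
  assumes x: "\<And>n. n \<ge> N \<Longrightarrow> x n = 0"
    and [measurable]: "f \<in> borel_measurable (PiM UNIV (\<lambda>_. borel))"
  shows "(\<integral>\<^sup>+z. f (\<lambda>n. x n + z n) \<partial>noise 1) =
    (\<integral>\<^sup>+y. ennreal (\<Prod>n<N. tilt (x n) (y n)) * f y \<partial>noise 1)"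
proof -
  note sh = measurable_noise_shift[of x 1 1]
  have "(\<integral>\<^sup>+z. f (\<lambda>n. x n + z n) \<partial>noise 1) = (\<integral>\<^sup>+y. f y \<partial>distr (noise 1) (noise 1) (\<lambda>z n. x n + z n))"
    by (subst nn_integral_distr[OF sh]) auto
  also have "\<dots> = (\<integral>\<^sup>+y. (\<Prod>n<N. ennreal (tilt (x n) (y n))) * f y \<partial>noise 1)"
    using distr_noise_shift[of N x] x by (simp add: nn_integral_density)
  finally show ?thesis by (simp add: prod_ennreal less_imp_le)
qed

section \<open>Hoelder's inequality and averaging over the parameter\<close>

text \<open>Young's inequality is applied pointwise to \<open>f / A\<close> and \<open>g / B\<close>
  and then integrated. Using bounds \<open>A\<close> and \<open>B\<close> in place of the integrals
  keeps every division by a positive real.\<close>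

lemma nn_integral_Holder_le:
  fixes f g :: "'a \<Rightarrow> real"
  assumes [measurable]: "f \<in> borel_measurable M" "g \<in> borel_measurable M"
    and fg: "\<And>x. 0 < f x" "\<And>x. 0 < g x"
    and le: "(\<integral>\<^sup>+x. ennreal (f x) \<partial>M) \<le> ennreal A" "(\<integral>\<^sup>+x. ennreal (g x) \<partial>M) \<le> ennreal B"
    and pos: "0 < A" "0 < B" and ab: "0 \<le> a" "0 \<le> b" "a + b = 1"
  shows "(\<integral>\<^sup>+x. ennreal (f x powr a * g x powr b) \<partial>M) \<le> ennreal (A powr a * B powr b)"
proof -
  define C where "C = A powr a * B powr b"
  have C: "C > 0" using pos by (simp add: C_def)
  have "ennreal (f x powr a * g x powr b) \<le> ennreal (C * a / A) * ennreal (f x) + ennreal (C * b / B) * ennreal (g x)" for x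
  proof -
    have "(f x / A) powr a * (g x / B) powr b \<le> a * (f x / A) + b * (g x / B)"
      using ab fg pos by (intro Youngs_inequality_0) auto
    moreover have "(f x / A) powr a * (g x / B) powr b = f x powr a * g x powr b / C"
      using fg pos by (simp add: powr_divide C_def)
    ultimately have "f x powr a * g x powr b / C \<le> a * (f x / A) + b * (g x / B)" by simp
    then have "f x powr a * g x powr b \<le> C * a / A * f x + C * b / B * g x"
      using C by (simp add: divide_le_eq algebra_simps)
    then have "ennreal (f x powr a * g x powr b) \<le> ennreal (C * a / A * f x + C * b / B * g x)"
      by (rule ennreal_leI)
    also have "\<dots> = ennreal (C * a / A) * ennreal (f x) + ennreal (C * b / B) * ennreal (g x)"
      using C pos ab less_imp_le[OF fg(1)] less_imp_le[OF fg(2)] by (subst ennreal_plus) (auto simp: ennreal_mult[symmetric])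
    finally show ?thesis .
  qed
  then have "(\<integral>\<^sup>+x. ennreal (f x powr a * g x powr b) \<partial>M) \<le>
      (\<integral>\<^sup>+x. ennreal (C * a / A) * ennreal (f x) + ennreal (C * b / B) * ennreal (g x) \<partial>M)"
    by (rule nn_integral_mono)
  also have "\<dots> = ennreal (C * a / A) * (\<integral>\<^sup>+x. ennreal (f x) \<partial>M) + ennreal (C * b / B) * (\<integral>\<^sup>+x. ennreal (g x) \<partial>M)"
    by (subst nn_integral_add) (auto simp: nn_integral_cmult)
  also have "\<dots> \<le> ennreal (C * a / A) * ennreal A + ennreal (C * b / B) * ennreal B"
    using le by (intro add_mono mult_left_mono) auto
  also have "\<dots> = ennreal (C * a + C * b)"
    using C pos ab by (simp add: ennreal_mult[symmetric] ennreal_plus[symmetric] del: ennreal_plus)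
  also have "C * a + C * b = C" using ab by (simp add: distrib_left[symmetric])
  finally show ?thesis by (simp add: C_def)
qed

text \<open>Splitting at \<open>c\<close> removes the absolute value; each half has a logarithmic
  primitive and contributes at most \<open>ln (1 + 1 / \<delta>)\<close>.\<close>

lemma nn_integral_inverse_distance_le:
  assumes c: "0 \<le> c" "c \<le> 1" and d: "\<delta> > 0"
  shows "(\<integral>\<^sup>+u. ennreal (1 / (\<bar>u - c\<bar> + \<delta>)) * indicator {0..<1} u \<partial>lborel) \<le> ennreal (2 * ln (1 + 1 / \<delta>))"
proof -
  have l: "ln (t + \<delta>) - ln \<delta> \<le> ln (1 + 1 / \<delta>)" if "0 \<le> t" "t \<le> 1" for t
  proof -
    have "ln (t + \<delta>) - ln \<delta> = ln ((t + \<delta>) / \<delta>)" using that d by (simp add: ln_div)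
    also have "(t + \<delta>) / \<delta> = 1 + t / \<delta>" using d by (simp add: field_simps)
    also have "ln (1 + t / \<delta>) \<le> ln (1 + 1 / \<delta>)"
      using that d by (subst ln_le_cancel_iff) (auto simp: add_pos_nonneg divide_right_mono add_pos_pos)
    finally show ?thesis .
  qed
  have 1: "(\<integral>\<^sup>+u. ennreal (1 / (\<bar>u - c\<bar> + \<delta>)) * indicator {0..c} u \<partial>lborel) = ennreal (ln (c + \<delta>) - ln \<delta>)"
  proof -
    have "(\<integral>\<^sup>+u. ennreal (1 / (\<bar>u - c\<bar> + \<delta>)) * indicator {0..c} u \<partial>lborel) =
        - ln (c - c + \<delta>) - - ln (c - 0 + \<delta>)"
      using c d by (intro nn_integral_FTC_Icc)
        (auto intro!: derivative_eq_intros simp: field_simps)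
    then show ?thesis by simp
  qed
  have 2: "(\<integral>\<^sup>+u. ennreal (1 / (\<bar>u - c\<bar> + \<delta>)) * indicator {c..1} u \<partial>lborel) = ennreal (ln (1 - c + \<delta>) - ln \<delta>)"
  proof -
    have "(\<integral>\<^sup>+u. ennreal (1 / (\<bar>u - c\<bar> + \<delta>)) * indicator {c..1} u \<partial>lborel) =
        ln (1 - c + \<delta>) - ln (c - c + \<delta>)"
      using c d by (intro nn_integral_FTC_Icc)
        (auto intro!: derivative_eq_intros simp: field_simps)
    then show ?thesis by simp
  qed
  have "(\<integral>\<^sup>+u. ennreal (1 / (\<bar>u - c\<bar> + \<delta>)) * indicator {0..<1} u \<partial>lborel) \<le>
     (\<integral>\<^sup>+u. ennreal (1 / (\<bar>u - c\<bar> + \<delta>)) * indicator {0..c} u + ennreal (1 / (\<bar>u - c\<bar> + \<delta>)) * indicator {c..1} u \<partial>lborel)"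
    by (intro nn_integral_mono) (auto split: split_indicator)
  also have "\<dots> = ennreal (ln (c + \<delta>) - ln \<delta>) + ennreal (ln (1 - c + \<delta>) - ln \<delta>)"
    unfolding 1[symmetric] 2[symmetric] by (intro nn_integral_add) auto
  also have "\<dots> \<le> ennreal (ln (1 + 1 / \<delta>)) + ennreal (ln (1 + 1 / \<delta>))"
    using c by (intro add_mono ennreal_leI l) auto
  also have "\<dots> = ennreal (2 * ln (1 + 1 / \<delta>))"
    using d by (simp add: ennreal_plus[symmetric] ln_ge_zero del: ennreal_plus)
  finally show ?thesis .
qed

text \<open>By Fubini the average over \<open>u\<close> is at most
  \<open>2 * ln (1 + 1 / \<delta>)\<close>, so some \<open>u\<close> does no worse than twice that.
  The slack between 2 and 4 makes the contradiction strict.\<close>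

lemma ex_parameter_inverse_distance_le:
  assumes [measurable]: "est \<in> borel_measurable M" and "sigma_finite_measure M"
    and [measurable]: "q \<in> borel_measurable M"
    and q: "(\<integral>\<^sup>+y. q y \<partial>M) = 1" and est: "\<And>y. 0 \<le> est y" "\<And>y. est y \<le> 1" and d: "\<delta> > 0"
  shows "\<exists>u\<in>{0..<1}. (\<integral>\<^sup>+y. q y * ennreal (1 / (\<bar>u - est y\<bar> + \<delta>)) \<partial>M) \<le> ennreal (4 * ln (1 + 1 / \<delta>))"
proof (rule ccontr)
  define B where "B = ln (1 + 1 / \<delta>)"
  have B: "B > 0" using d unfolding B_def by (intro ln_gt_zero) simp
  define b where "b u = (\<integral>\<^sup>+y. q y * ennreal (1 / (\<bar>u - est y\<bar> + \<delta>)) \<partial>M)" for u :: real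
  interpret M: sigma_finite_measure M by fact
  interpret pair_sigma_finite lborel M ..
  assume "\<not> ?thesis"
  then have "ennreal (4 * B) \<le> b u" if "u \<in> {0..<1}" for u
    using that by (auto simp: b_def B_def not_le intro: less_imp_le)
  then have "(\<integral>\<^sup>+u. ennreal (4 * B) * indicator {0..<1::real} u \<partial>lborel) \<le> (\<integral>\<^sup>+u. b u * indicator {0..<1::real} u \<partial>lborel)"
    by (auto intro!: nn_integral_mono split: split_indicator)
  also have "\<dots> = (\<integral>\<^sup>+u. (\<integral>\<^sup>+y. q y * ennreal (1 / (\<bar>u - est y\<bar> + \<delta>)) * indicator {0..<1} u \<partial>M) \<partial>lborel)"
    unfolding b_def by (intro nn_integral_cong nn_integral_multc[symmetric]) auto
  also have "\<dots> = (\<integral>\<^sup>+y. (\<integral>\<^sup>+u. q y * ennreal (1 / (\<bar>u - est y\<bar> + \<delta>)) * indicator {0..<1} u \<partial>lborel) \<partial>M)"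
    by (rule Fubini'[symmetric]) auto
  also have "\<dots> = (\<integral>\<^sup>+y. q y * (\<integral>\<^sup>+u. ennreal (1 / (\<bar>u - est y\<bar> + \<delta>)) * indicator {0..<1} u \<partial>lborel) \<partial>M)"
    unfolding mult.assoc by (intro nn_integral_cong nn_integral_cmult) auto
  also have "\<dots> \<le> (\<integral>\<^sup>+y. q y * ennreal (2 * B) \<partial>M)"
    unfolding B_def using est d by (intro nn_integral_mono mult_left_mono nn_integral_inverse_distance_le) auto
  also have "\<dots> = ennreal (2 * B)"
    by (subst nn_integral_multc) (auto simp: q)
  also have "(\<integral>\<^sup>+u. ennreal (4 * B) * indicator {0..<1::real} u \<partial>lborel) = ennreal (4 * B)"
    by (subst nn_integral_cmult_indicator) auto
  finally show False using B by simp
qed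

section \<open>Converse\<close>

text \<open>A bound through the maximum, valid for exponents below and above 1 alike; the constant
  factor disappears on the exponential scale.\<close>

lemma powr_add_le:
  fixes a b c :: real
  assumes "a \<ge> 0" "b \<ge> 0" "c \<ge> 0"
  shows "(a + b) powr c \<le> 2 powr c * (a powr c + b powr c)"
proof -
  have "(a + b) powr c \<le> (2 * max a b) powr c" using assms by (intro powr_mono2) auto
  also have "\<dots> = 2 powr c * (max a b) powr c" using assms by (simp add: powr_mult)
  also have "(max a b) powr c \<le> a powr c + b powr c" by (auto simp: max_def)
  finally show ?thesis by simp
qed

text \<open>Non-asymptotic form of the lower bound on the error, for a fixed dimension
  \<open>N\<close> and energy bound \<open>S\<close>. The reference variance \<open>v\<close> and
  the smoothing \<delta> stay free, to be chosen once the duration is known.\<close>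

lemma system_converse:
  fixes s :: "real \<Rightarrow> nat \<Rightarrow> real" and est :: "(nat \<Rightarrow> real) \<Rightarrow> real"
  assumes est [measurable]: "est \<in> borel_measurable (PiM UNIV (\<lambda>_. borel))"
    and s0: "\<And>u n. u \<in> {0..<1} \<Longrightarrow> n \<ge> N \<Longrightarrow> s u n = 0"
    and sP: "\<And>u. u \<in> {0..<1} \<Longrightarrow> (\<Sum>n<N. (s u n)\<^sup>2) \<le> S"
    and err: "mpae \<alpha> 1 s est \<le> ennreal e"
    and pos: "\<alpha> > 0" "v > 0" "\<delta> > 0" "e \<ge> 0"
  shows "- (real N / 2 * ((1 + \<alpha>) * ln ((v + \<alpha>) / (1 + \<alpha>)) - ln v) + \<alpha> * S / (v + \<alpha>)) \<le>
    ln (2 powr \<alpha> * (e + \<delta> powr \<alpha>)) + \<alpha> * ln (4 * ln (1 + 1 / \<delta>))"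
proof -
  interpret prob_space "noise 1" by (rule prob_space_noise_1)
  \<comment> \<open>Clipping the estimate to the unit interval does not increase the error.\<close>
  define c where "c y = max 0 (min 1 (est y))" for y
  have c01: "0 \<le> c y" "c y \<le> 1" for y by (auto simp: c_def)
  have c_meas [measurable]: "c \<in> borel_measurable (PiM UNIV (\<lambda>_. borel))"
    unfolding c_def by measurable
  define q where "q y = (\<Prod>n<N. widen v (y n))" for y :: "nat \<Rightarrow> real"
  have q_meas [measurable]: "q \<in> borel_measurable (PiM UNIV (\<lambda>_. borel))"
    unfolding q_def by measurable
  have q0: "q y > 0" for y using pos by (auto simp: q_def intro!: prod_pos)
  have "(\<integral>\<^sup>+y. ennreal (q y) \<partial>noise 1) = (\<integral>\<^sup>+y. (\<Prod>n<N. ennreal (widen v (y n))) \<partial>noise 1)"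
    using pos by (simp add: q_def prod_ennreal less_imp_le)
  also have "\<dots> = 1"
    using pos by (subst nn_integral_noise_prod) (auto simp: nn_integral_widen)
  finally have q1: "(\<integral>\<^sup>+y. ennreal (q y) \<partial>noise 1) = 1" .
  define B where "B = 4 * ln (1 + 1 / \<delta>)"
  have B: "B > 0" unfolding B_def using pos by (intro mult_pos_pos ln_gt_zero) auto
  \<comment> \<open>A single good parameter suffices, because \<open>mpae\<close> bounds the error
    at every parameter.\<close>
  obtain u where u: "u \<in> {0..<1}" and b: "(\<integral>\<^sup>+y. ennreal (q y) * ennreal (1 / (\<bar>u - c y\<bar> + \<delta>)) \<partial>noise 1) \<le> ennreal B"
    using ex_parameter_inverse_distance_le[of c "noise 1" "\<lambda>y. ennreal (q y)" \<delta>] c01 q1 pos sigma_finite_measure_axioms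
    unfolding B_def by auto
  define r where "r y = \<bar>u - c y\<bar> + \<delta>" for y
  have r0: "r y > 0" for y using pos by (simp add: r_def add_nonneg_pos)
  have r_meas [measurable]: "r \<in> borel_measurable (PiM UNIV (\<lambda>_. borel))"
    unfolding r_def by measurable
  define L where "L y = (\<Prod>n<N. tilt (s u n) (y n))" for y
  have L0: "L y > 0" for y by (auto simp: L_def intro!: prod_pos)
  have L_meas [measurable]: "L \<in> borel_measurable (PiM UNIV (\<lambda>_. borel))"
    unfolding L_def by measurable
  define A where "A = 2 powr \<alpha> * (e + \<delta> powr \<alpha>)"
  have A: "A > 0" using pos by (simp add: A_def add_nonneg_pos)
  \<comment> \<open>Conjugate Hoelder exponents with \<alpha> * \<open>a\<close> = \<open>b\<close>,
    which makes the powers of \<open>r\<close> cancel below.\<close>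
  define a where "a = 1 / (1 + \<alpha>)"
  define b where "b = \<alpha> / (1 + \<alpha>)"
  have ab: "a > 0" "b > 0" "a + b = 1" "\<alpha> * a = b" using pos by (auto simp: a_def b_def field_simps)

  have "(\<integral>\<^sup>+y. ennreal (L y * r y powr \<alpha>) \<partial>noise 1) = (\<integral>\<^sup>+y. ennreal (L y) * ennreal (r y powr \<alpha>) \<partial>noise 1)"
    using L0 by (simp add: ennreal_mult less_imp_le)
  also have "\<dots> = (\<integral>\<^sup>+z. ennreal (r (\<lambda>n. s u n + z n) powr \<alpha>) \<partial>noise 1)"
    unfolding L_def using s0[OF u] by (intro nn_integral_noise_shift[symmetric]) auto
  also have "\<dots> \<le> (\<integral>\<^sup>+z. ennreal (2 powr \<alpha>) * (ennreal (\<bar>est (\<lambda>n. s u n + z n) - u\<bar> powr \<alpha>) + ennreal (\<delta> powr \<alpha>)) \<partial>noise 1)"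
  proof (rule nn_integral_mono)
    fix z
    define y where "y = (\<lambda>n. s u n + z n)"
    have "\<bar>u - c y\<bar> \<le> \<bar>est y - u\<bar>" using u by (auto simp: c_def)
    then have "r y powr \<alpha> \<le> (\<bar>est y - u\<bar> + \<delta>) powr \<alpha>"
      using pos by (intro powr_mono2) (auto simp: r_def)
    also have "\<dots> \<le> 2 powr \<alpha> * (\<bar>est y - u\<bar> powr \<alpha> + \<delta> powr \<alpha>)"
      using pos by (intro powr_add_le) auto
    finally show "ennreal (r (\<lambda>n. s u n + z n) powr \<alpha>) \<le>
        ennreal (2 powr \<alpha>) * (ennreal (\<bar>est (\<lambda>n. s u n + z n) - u\<bar> powr \<alpha>) + ennreal (\<delta> powr \<alpha>))"
      unfolding y_def[symmetric]
      by (simp add: ennreal_plus[symmetric] ennreal_mult[symmetric] ennreal_leI del: ennreal_plus)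
  qed
  also have "\<dots> = ennreal (2 powr \<alpha>) * ((\<integral>\<^sup>+z. ennreal (\<bar>est (\<lambda>n. s u n + z n) - u\<bar> powr \<alpha>) \<partial>noise 1) + ennreal (\<delta> powr \<alpha>))"
  proof -
    have [measurable]: "(\<lambda>z. est (\<lambda>n. s u n + z n)) \<in> borel_measurable (noise 1)"
      by (rule measurable_compose[OF measurable_noise_shift[of "s u" 1 1]]) simp
    show ?thesis by (simp add: nn_integral_cmult nn_integral_add emeasure_space_1[simplified])
  qed
  also have "\<dots> \<le> ennreal (2 powr \<alpha>) * (ennreal e + ennreal (\<delta> powr \<alpha>))"
  proof (intro mult_left_mono add_right_mono)
    have "(\<integral>\<^sup>+z. ennreal (\<bar>est (\<lambda>n. s u n + z n) - u\<bar> powr \<alpha>) \<partial>noise 1) \<le> mpae \<alpha> 1 s est"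
      unfolding mpae_def using u by (rule SUP_upper)
    then show "(\<integral>\<^sup>+z. ennreal (\<bar>est (\<lambda>n. s u n + z n) - u\<bar> powr \<alpha>) \<partial>noise 1) \<le> ennreal e"
      using err by simp
  qed simp
  also have "\<dots> = ennreal A"
    using pos by (simp add: A_def ennreal_plus[symmetric] ennreal_mult[symmetric] del: ennreal_plus)
  finally have fA: "(\<integral>\<^sup>+y. ennreal (L y * r y powr \<alpha>) \<partial>noise 1) \<le> ennreal A" .

  have gB: "(\<integral>\<^sup>+y. ennreal (q y / r y) \<partial>noise 1) \<le> ennreal B"
  proof -
    have "ennreal (q y / r y) = ennreal (q y) * ennreal (1 / r y)" for y
      using less_imp_le[OF q0] less_imp_le[OF r0] by (simp add: ennreal_mult[symmetric])
    then show ?thesis using b by (simp add: r_def)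
  qed

  \<comment> \<open>\<open>h x\<close> is the logarithm of the one-dimensional affinity when the
    signal coordinate is \<open>x\<close>.\<close>
  define h where "h x = - (ln v * (\<alpha> / (1 + \<alpha>)) + ln ((v + \<alpha>) / ((1 + \<alpha>) * v))) / 2 - \<alpha> * x\<^sup>2 / ((1 + \<alpha>) * (v + \<alpha>))" for x
  have "ennreal (exp (\<Sum>n<N. h (s u n))) = (\<Prod>n<N. ennreal (exp (h (s u n))))"
    by (simp add: exp_sum prod_ennreal)
  also have "\<dots> = (\<Prod>n<N. \<integral>\<^sup>+y. ennreal (tilt (s u n) y powr a * widen v y powr b) \<partial>gauss)"
    unfolding h_def a_def b_def using pos by (simp add: nn_integral_tilt_widen)
  also have "\<dots> = (\<integral>\<^sup>+y. (\<Prod>n<N. ennreal (tilt (s u n) (y n) powr a * widen v (y n) powr b)) \<partial>noise 1)"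
    by (subst nn_integral_noise_prod) auto
  also have "\<dots> = (\<integral>\<^sup>+y. ennreal ((L y * r y powr \<alpha>) powr a * (q y / r y) powr b) \<partial>noise 1)"
  proof (rule nn_integral_cong)
    fix y
    have "(L y * r y powr \<alpha>) powr a * (q y / r y) powr b = L y powr a * q y powr b"
      using L0[of y] r0[of y] q0[of y] ab by (simp add: powr_mult powr_divide powr_powr)
    also have "\<dots> = (\<Prod>n<N. tilt (s u n) (y n) powr a * widen v (y n) powr b)"
      using pos by (simp add: L_def q_def prod_powr_distrib less_imp_le prod.distrib)
    finally show "(\<Prod>n<N. ennreal (tilt (s u n) (y n) powr a * widen v (y n) powr b)) =
        ennreal ((L y * r y powr \<alpha>) powr a * (q y / r y) powr b)"
      by (simp add: prod_ennreal)
  qed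
  also have "\<dots> \<le> ennreal (A powr a * B powr b)"
  proof (rule nn_integral_Holder_le)
    show "0 < L y * r y powr \<alpha>" "0 < q y / r y" for y
      using L0[of y] r0[of y] q0[of y] by auto
  qed (use fA gB A B ab in auto)
  finally have "exp (\<Sum>n<N. h (s u n)) \<le> A powr a * B powr b"
    by (simp add: ennreal_le_iff)
  then have "ln (exp (\<Sum>n<N. h (s u n))) \<le> ln (A powr a * B powr b)"
    using A B by (subst ln_le_cancel_iff) auto
  then have "(\<Sum>n<N. h (s u n)) \<le> a * ln A + b * ln B"
    using A B by (simp add: ln_mult ln_powr)
  \<comment> \<open>Multiplying by 1 + \<alpha> undoes the Hoelder exponents: \<open>A\<close> gets
    weight 1 and \<open>B\<close> gets weight \<alpha>.\<close>
  then have "(1 + \<alpha>) * (\<Sum>n<N. h (s u n)) \<le> (1 + \<alpha>) * (a * ln A + b * ln B)"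
    using pos by (intro mult_left_mono) auto
  also have "\<dots> = ln A + \<alpha> * ln B"
    using pos by (simp add: a_def b_def distrib_left)
  finally have 1: "(1 + \<alpha>) * (\<Sum>n<N. h (s u n)) \<le> ln A + \<alpha> * ln B" .
  define k where "k = (1 + \<alpha>) * ln ((v + \<alpha>) / (1 + \<alpha>)) - ln v"
  have hx: "(1 + \<alpha>) * h x = - k / 2 - \<alpha> / (v + \<alpha>) * x\<^sup>2" for x
  proof -
    have "ln ((v + \<alpha>) / ((1 + \<alpha>) * v)) = ln ((v + \<alpha>) / (1 + \<alpha>)) - ln v"
      using pos by (simp add: ln_div ln_mult)
    moreover define m where "m = 1 + \<alpha>"
    moreover have "m \<noteq> 0" "v + \<alpha> \<noteq> 0" "\<alpha> = m - 1" using pos by (auto simp: m_def)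
    ultimately show ?thesis
      unfolding h_def k_def m_def[symmetric] by (simp add: divide_simps) (simp add: algebra_simps)
  qed
  have "(1 + \<alpha>) * (\<Sum>n<N. h (s u n)) = - (real N / 2 * k) - \<alpha> / (v + \<alpha>) * (\<Sum>n<N. (s u n)\<^sup>2)"
    unfolding sum_distrib_left hx by (simp add: sum_subtractf)
  \<comment> \<open>The power constraint enters only here: the affinity depends on the signal
    through its energy alone.\<close>
  moreover have "\<alpha> / (v + \<alpha>) * (\<Sum>n<N. (s u n)\<^sup>2) \<le> \<alpha> / (v + \<alpha>) * S"
    using pos sP[OF u] by (intro mult_left_mono) auto
  ultimately show ?thesis using 1 unfolding A_def B_def k_def by simp
qed

section \<open>From fixed durations to exponents\<close>

text \<open>The extended values of \<open>rate\<close> fit this reading: a zero error satisfies any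
  bound, and an infinite error has rate -\<infinity>, which exceeds no real.\<close>

lemma rate_gt_imp_le:
  assumes "T > 0" "rate T e > ereal E"
  shows "e \<le> ennreal (exp (- E * T))"
proof (cases e)
  case (real x)
  show ?thesis
  proof (cases "x = 0")
    case False
    then have "E < - ln x / T" "x > 0" using assms real by (auto simp: rate_def split: if_splits)
    then have "ln x < - E * T" using assms by (simp add: field_simps)
    then have "x < exp (- E * T)" using \<open>x > 0\<close> by (metis exp_less_cancel_iff exp_ln)
    then show ?thesis using real by (simp add: ennreal_leI)
  qed (use real in simp)
qed (use assms in \<open>auto simp: rate_def split: if_splits\<close>)

lemma achievable_le_E0:
  assumes \<alpha>: "\<alpha> > 0" and \<Gamma>: "\<Gamma> > 0" and ach: "achievable \<alpha> \<Gamma> 1 1 E"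
  shows "E \<le> 2 * E0 \<alpha> \<Gamma>"
proof (rule ccontr)
  define v where "v = opt_var \<alpha> \<Gamma>"
  have v: "v > 0" using assms opt_var_pos by (simp add: v_def)
  define k where "k = (1 + \<alpha>) * ln ((v + \<alpha>) / (1 + \<alpha>)) - ln v"
  have k: "k \<ge> 0" using ln_shifted_mean_ge[OF \<alpha> v] by (simp add: k_def)
  have E0: "2 * E0 \<alpha> \<Gamma> = k + \<alpha> * \<Gamma> / (v + \<alpha>)"
    using two_E0_eq[OF \<alpha> \<Gamma>] by (simp add: k_def v_def)
  have E0nn: "2 * E0 \<alpha> \<Gamma> \<ge> 0" unfolding E0 using k v \<alpha> \<Gamma> by simp
  assume "\<not> ?thesis"
  then have E: "E > 2 * E0 \<alpha> \<Gamma>" by simp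
  \<comment> \<open>An intermediate exponent: below \<open>E\<close>, so that the limit superior
    exceeds it, yet above \<open>2 * E0\<close>, so that a linear gap in \<open>T\<close>
    remains.\<close>
  define E' where "E' = (E + 2 * E0 \<alpha> \<Gamma>) / 2"
  have E': "2 * E0 \<alpha> \<Gamma> < E'" "E' < E" "E' > 0" using E E0nn by (auto simp: E'_def field_simps)
  obtain s est where vs: "\<And>T. T > 0 \<Longrightarrow> valid_system \<Gamma> 1 T (s T) (est T)"
    and lim: "Limsup at_top (\<lambda>T. rate T (mpae \<alpha> 1 (s T) (est T))) \<ge> ereal E"
    using ach by (auto simp: achievable_def)
  \<comment> \<open>A limit superior gives good systems only for arbitrarily large \<open>T\<close>,
    not for all large \<open>T\<close>; one such \<open>T\<close> is enough.\<close>
  have freq: "\<exists>\<^sub>F T in at_top. rate T (mpae \<alpha> 1 (s T) (est T)) > ereal E'"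
  proof (rule ccontr)
    assume "\<not> ?thesis"
    then have "\<forall>\<^sub>F T in at_top. rate T (mpae \<alpha> 1 (s T) (est T)) \<le> ereal E'"
      by (simp add: not_frequently not_less)
    then have "Limsup at_top (\<lambda>T. rate T (mpae \<alpha> 1 (s T) (est T))) \<le> ereal E'"
      by (rule Limsup_bounded)
    with lim have "ereal E \<le> ereal E'" by (rule order_trans)
    with E' show False by simp
  qed
  define d where "d = E' - 2 * E0 \<alpha> \<Gamma>"
  have d: "d > 0" using E' by (simp add: d_def)
  \<comment> \<open>The linear gap \<open>d * T\<close> outgrows the logarithmic loss from averaging
    over the parameter.\<close>
  have "filterlim (\<lambda>T. d * T - ((\<alpha> + 1) * ln 2 + \<alpha> * ln (4 * (1 + E' / \<alpha> * T)))) at_top at_top"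
    using d \<open>E' > 0\<close> \<alpha> by real_asymp
  then have "\<forall>\<^sub>F T in at_top. d * T - ((\<alpha> + 1) * ln 2 + \<alpha> * ln (4 * (1 + E' / \<alpha> * T))) > 0"
    by (simp only: filterlim_at_top_dense)
  then have "\<forall>\<^sub>F T in at_top. T > 0 \<and> d * T > (\<alpha> + 1) * ln 2 + \<alpha> * ln (4 * (1 + E' / \<alpha> * T))"
    using eventually_gt_at_top[of 0] by eventually_elim simp
  then have "\<exists>\<^sub>F T in at_top. rate T (mpae \<alpha> 1 (s T) (est T)) > ereal E' \<and>
      T > 0 \<and> d * T > (\<alpha> + 1) * ln 2 + \<alpha> * ln (4 * (1 + E' / \<alpha> * T))"
    using freq by (auto elim: frequently_rev_mp eventually_mono)
  then obtain T where T: "rate T (mpae \<alpha> 1 (s T) (est T)) > ereal E'" "T > 0"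
      and gt: "d * T > (\<alpha> + 1) * ln 2 + \<alpha> * ln (4 * (1 + E' / \<alpha> * T))"
    by (auto dest: frequently_ex)
  define N where "N = dims 1 T"
  have N: "real N \<le> 2 * T" using T by (simp add: N_def dims_def)
  \<comment> \<open>With this choice \<delta> to the power \<alpha> equals the error bound, so
    smoothing costs a factor 2, while \<open>ln (1 / \<delta>)\<close> grows only linearly in
    \<open>T\<close>.\<close>
  define \<delta> where "\<delta> = exp (- (E' / \<alpha> * T))"
  have "- (real N / 2 * k + \<alpha> * (\<Gamma> * T) / (v + \<alpha>)) \<le>
      ln (2 powr \<alpha> * (exp (- E' * T) + \<delta> powr \<alpha>)) + \<alpha> * ln (4 * ln (1 + 1 / \<delta>))"
    unfolding k_def
  proof (rule system_converse[where s = "s T" and est = "est T"])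
    show "mpae \<alpha> 1 (s T) (est T) \<le> ennreal (exp (- E' * T))"
      using rate_gt_imp_le[OF T(2,1)] .
  qed (use vs[OF T(2)] \<alpha> v in \<open>auto simp: valid_system_def N_def \<delta>_def\<close>)
  \<comment> \<open>The floor in \<open>dims\<close> gives \<open>N\<close> \<le>
    \<open>2 * T\<close>; nonnegativity of \<open>k\<close> makes the replacement go in the right
    direction.\<close>
  moreover have "real N / 2 * k \<le> T * k" using N k by (intro mult_right_mono) auto
  moreover have "T * k + \<alpha> * (\<Gamma> * T) / (v + \<alpha>) = 2 * E0 \<alpha> \<Gamma> * T"
    unfolding E0 by (simp add: algebra_simps)
  moreover have "ln (2 powr \<alpha> * (exp (- E' * T) + \<delta> powr \<alpha>)) = (\<alpha> + 1) * ln 2 - E' * T"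
  proof -
    have "\<delta> powr \<alpha> = exp (- E' * T)" using \<alpha> by (simp add: \<delta>_def powr_def)
    then have "2 powr \<alpha> * (exp (- E' * T) + \<delta> powr \<alpha>) = 2 powr \<alpha> * (2 * exp (- E' * T))" by simp
    then show ?thesis by (simp add: ln_mult ln_powr distrib_right)
  qed
  moreover have "\<alpha> * ln (4 * ln (1 + 1 / \<delta>)) \<le> \<alpha> * ln (4 * (1 + E' / \<alpha> * T))"
  proof -
    have x: "E' / \<alpha> * T > 0" using E' \<alpha> T by simp
    have "1 + 1 / \<delta> = 1 + exp (E' / \<alpha> * T)" by (simp add: \<delta>_def exp_minus inverse_eq_divide)
    also have "\<dots> \<le> exp 1 * exp (E' / \<alpha> * T)"
    proof -
      have "1 + exp (E' / \<alpha> * T) \<le> 2 * exp (E' / \<alpha> * T)" using x one_le_exp_iff[of "E' / \<alpha> * T"] by linarith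
      also have "\<dots> \<le> exp 1 * exp (E' / \<alpha> * T)"
        using exp_ge_add_one_self[of 1] by (intro mult_right_mono) auto
      finally show ?thesis .
    qed
    also have "\<dots> = exp (1 + E' / \<alpha> * T)" by (simp add: exp_add)
    finally have "ln (1 + 1 / \<delta>) \<le> ln (exp (1 + E' / \<alpha> * T))"
      by (subst ln_le_cancel_iff) (auto simp: \<delta>_def add_pos_pos)
    then have "ln (1 + 1 / \<delta>) \<le> 1 + E' / \<alpha> * T" by simp
    moreover have "ln (1 + 1 / \<delta>) > 0" by (intro ln_gt_zero) (simp add: \<delta>_def)
    ultimately show ?thesis using \<alpha> by (intro mult_left_mono) auto
  qed
  ultimately have "d * T \<le> (\<alpha> + 1) * ln 2 + \<alpha> * ln (4 * (1 + E' / \<alpha> * T))"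
    unfolding d_def left_diff_distrib by linarith
  with gt show False by simp
qed

theorem mainTheorem1:
  fixes \<alpha> \<Gamma> :: real
  assumes "\<alpha> > 0" and "\<Gamma> > 0"
  shows "F_exp \<alpha> \<Gamma> \<le> min (ereal (2 * E0 \<alpha> \<Gamma>)) (gamma_exp \<alpha> * ereal \<Gamma>)"
proof (rule min.boundedI)
  show "F_exp \<alpha> \<Gamma> \<le> ereal (2 * E0 \<alpha> \<Gamma>)"
    unfolding F_exp_def opt_exp_def
    using achievable_le_E0[OF assms] by (auto intro!: Sup_least)
  show "F_exp \<alpha> \<Gamma> \<le> gamma_exp \<alpha> * ereal \<Gamma>"
    using assms(2) by (rule F_exp_le_gamma_exp)
qed

end
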